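(* Let $\mathcal H$ be a complex separable Hilbert space, let $A,B$ be positive invertible bounded linear operators on $\mathcal H$, and let $m,m',M,M'$ be positive real numbers satisfying either $0<m'I\le A\le mI<MI\le B\le M'I$ or $0<m'I\le B\le mI<MI\le A\le M'I$. Let $v\in(0,1)$ and put $h=\frac{M}{m}$, $r=\min\{v,1-v\}$, $R=\max\{v,1-v\}$, $r_1=\min\{2r,1-2r\}$ and $\hat r_1=\min\{2r_1,1-2r_1\}$. Then $$A\nabla B\ \le\ 2R(A\nabla B-A\#B)-r_1\bigl(A\nabla B+A\#B-2H_{\frac14}(A,B)\bigr)+\mathrm{K}(\sqrt[4]{h},2)^{-\hat r_1}H_v(A,B).$$
   Context: $I$ is the identity operator on $\mathcal H$, and inequalities between self-adjoint operators are in the usual (Loewner) operator order; $mI<MI$ means $m<M$. For positive invertible $A,B$ and $v\in[0,1]$: $A\nabla_v B=(1-v)A+vB$ and $A\#_v B=A^{1/2}(A^{-1/2}BA^{-1/2})^vA^{1/2}$; for $v=\frac12$ one writes $A\nabla B$ and $A\#B$. The Heinz operator mean is $H_v(A,B)=\frac{A\#_vB+A\#_{1-v}B}{2}$. For $t>0$, $\mathrm{K}(t,2)=\frac{(t+1)^2}{4t}$ denotes the Kantorovich constant. *)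

theory Defs
  imports "HOL-Analysis.Analysis"
begin

text \<open>
  Complex Hilbert spaces, as a class extending the real one: the real inner product is the real
  part of the complex one, so norm and completeness are the usual ones (positive definiteness of
  \<open>cinner\<close> is inherited from \<open>inner\<close>). The complex inner product is linear in its first argument.
\<close>

class complex_hilbert = real_inner + banach +
  fixes scaleC :: "complex \<Rightarrow> 'a \<Rightarrow> 'a"  (infixr \<open>*\<^sub>C\<close> 75)
    and cinner :: "'a \<Rightarrow> 'a \<Rightarrow> complex"
  assumes scaleC_add_right: "c *\<^sub>C (x + y) = c *\<^sub>C x + c *\<^sub>C y"
    and scaleC_add_left: "(c + d) *\<^sub>C x = c *\<^sub>C x + d *\<^sub>C x"
    and scaleC_scaleC: "c *\<^sub>C d *\<^sub>C x = (c * d) *\<^sub>C x"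
    and scaleC_of_real: "complex_of_real a *\<^sub>C x = a *\<^sub>R x"
    and cinner_commute: "cinner x y = cnj (cinner y x)"
    and cinner_add_left: "cinner (x + y) z = cinner x z + cinner y z"
    and cinner_scaleC_left: "cinner (c *\<^sub>C x) y = c * cinner x y"
    and Re_cinner: "Re (cinner x y) = inner x y"

instantiation complex :: complex_hilbert
begin

definition scaleC_complex :: "complex \<Rightarrow> complex \<Rightarrow> complex"
  where "scaleC_complex c x = c * x"

definition cinner_complex :: "complex \<Rightarrow> complex \<Rightarrow> complex"
  where "cinner_complex x y = x * cnj y"

instance
  by standard
    (simp_all add: scaleC_complex_def cinner_complex_def algebra_simps scaleR_conv_of_real
      inner_complex_def)

end

text \<open>
  Operators are elements of \<open>'a \<Rightarrow>\<^sub>L 'a\<close>, i.e. bounded and a priori only real-linear;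
  complex linearity is the following predicate.
\<close>

type_synonym 'a operator = "'a \<Rightarrow>\<^sub>L 'a"

definition complex_linear :: "'a::complex_hilbert operator \<Rightarrow> bool"
  where "complex_linear A \<longleftrightarrow> (\<forall>c x. blinfun_apply A (c *\<^sub>C x) = c *\<^sub>C blinfun_apply A x)"

text \<open>An inverse of a complex-linear operator is automatically complex-linear.\<close>

definition invertible_op :: "'a::complex_hilbert operator \<Rightarrow> bool"
  where "invertible_op A \<longleftrightarrow>
    (\<exists>C. A o\<^sub>L C = id_blinfun \<and> C o\<^sub>L A = id_blinfun)"

definition selfadjoint :: "'a::complex_hilbert operator \<Rightarrow> bool"
  where "selfadjoint A \<longleftrightarrow>
    (\<forall>x y. cinner (blinfun_apply A x) y = cinner x (blinfun_apply A y))"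

definition positive_op :: "'a::complex_hilbert operator \<Rightarrow> bool"
  where "positive_op A \<longleftrightarrow> selfadjoint A \<and> (\<forall>x. 0 \<le> Re (cinner (blinfun_apply A x) x))"

definition loewner_le :: "'a::complex_hilbert operator \<Rightarrow> 'a operator \<Rightarrow> bool"  (infix \<open>\<preceq>\<close> 50)
  where "A \<preceq> B \<longleftrightarrow> positive_op (B - A)"

lemma bounded_linear_scaleC: "bounded_linear (\<lambda>x::'a::complex_hilbert. c *\<^sub>C x)"
proof (rule bounded_linear_intro)
  fix x y :: 'a and a :: real
  show "c *\<^sub>C (x + y) = c *\<^sub>C x + c *\<^sub>C y"
    by (rule scaleC_add_right)
  show "c *\<^sub>C (a *\<^sub>R x) = a *\<^sub>R (c *\<^sub>C x)"
    by (simp add: scaleC_of_real [symmetric] scaleC_scaleC mult.commute)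
  have real: "cinner x x = of_real (inner x x)"
    using cinner_commute [of x x] Re_cinner [of x x]
    by (simp add: complex_eq_iff)
  have right: "cinner x (c *\<^sub>C x) = cnj c * cinner x x"
    by (subst (1 2) cinner_commute) (simp add: cinner_scaleC_left)
  have "cinner (c *\<^sub>C x) (c *\<^sub>C x) = (c * cnj c) * cinner x x"
    by (simp add: cinner_scaleC_left right)
  also have "\<dots> = of_real ((cmod c)\<^sup>2 * inner x x)"
    by (simp only: real complex_norm_square [symmetric] of_real_mult)
  finally have "inner (c *\<^sub>C x) (c *\<^sub>C x) = (cmod c)\<^sup>2 * inner x x"
    by (simp only: Re_cinner [symmetric] Re_complex_of_real)
  then have "(norm (c *\<^sub>C x))\<^sup>2 = (norm x * cmod c)\<^sup>2"
    by (simp add: power2_norm_eq_inner power_mult_distrib)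
  then show "norm (c *\<^sub>C x) \<le> norm x * cmod c"
    by (metis power2_le_imp_le order_refl mult_nonneg_nonneg norm_ge_zero)
qed

text \<open>By the preceding lemma, \<open>Blinfun\<close> is applied here to a genuine bounded operator.\<close>

definition scalar_op :: "complex \<Rightarrow> 'a::complex_hilbert operator"
  where "scalar_op c = Blinfun (\<lambda>x. c *\<^sub>C x)"

definition op_spectrum :: "'a::complex_hilbert operator \<Rightarrow> complex set"
  where "op_spectrum A = {z. \<not> invertible_op (A - scalar_op z)}"

definition poly_op :: "real poly \<Rightarrow> 'a::complex_hilbert operator \<Rightarrow> 'a operator"
  where "poly_op p A =
    (\<Sum>i\<le>degree p. coeff p i *\<^sub>R ((blinfun_compose A) ^^ i) id_blinfun)"

text \<open>
  Continuous functional calculus of a self-adjoint operator \<open>A\<close>, for real functions \<open>f\<close> continuous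
  on its (real) spectrum: \<open>f(A)\<close> is the norm limit of \<open>p\<^sub>n(A)\<close> for any real polynomials \<open>p\<^sub>n\<close>
  converging to \<open>f\<close> uniformly on the spectrum. Such polynomials exist by Weierstrass, and the
  limit exists and is independent of their choice because
  \<open>\<parallel>p(A)\<parallel>\<close> is the supremum of \<open>\<bar>p\<bar>\<close> over the spectrum.
\<close>

definition fun_calc :: "(real \<Rightarrow> real) \<Rightarrow> 'a::complex_hilbert operator \<Rightarrow> 'a operator"
  where "fun_calc f A = (THE T. \<forall>p :: nat \<Rightarrow> real poly.
    uniform_limit {t. complex_of_real t \<in> op_spectrum A} (\<lambda>n t. poly (p n) t) f sequentially
      \<longrightarrow> (\<lambda>n. poly_op (p n) A) \<longlonglongrightarrow> T)"

definition op_powr :: "'a::complex_hilbert operator \<Rightarrow> real \<Rightarrow> 'a operator"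
  where "op_powr A s = fun_calc (\<lambda>t. t powr s) A"

definition arith_mean :: "real \<Rightarrow> 'a::complex_hilbert operator \<Rightarrow> 'a operator \<Rightarrow> 'a operator"
  where "arith_mean v A B = (1 - v) *\<^sub>R A + v *\<^sub>R B"

definition geom_mean :: "real \<Rightarrow> 'a::complex_hilbert operator \<Rightarrow> 'a operator \<Rightarrow> 'a operator"
  where "geom_mean v A B =
    op_powr A (1/2) o\<^sub>L
      op_powr (op_powr A (-1/2) o\<^sub>L B o\<^sub>L op_powr A (-1/2)) v
    o\<^sub>L op_powr A (1/2)"

definition heinz_mean :: "real \<Rightarrow> 'a::complex_hilbert operator \<Rightarrow> 'a operator \<Rightarrow> 'a operator"
  where "heinz_mean v A B = (1/2) *\<^sub>R (geom_mean v A B + geom_mean (1 - v) A B)"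

text \<open>The Kantorovich constant \<open>K(t, 2)\<close>.\<close>

definition kantorovich2 :: "real \<Rightarrow> real"
  where "kantorovich2 t = (t + 1)\<^sup>2 / (4 * t)"

end

theory Submission
  imports Defs "HOL-Computational_Algebra.Fundamental_Theorem_Algebra"
begin

text \<open>
  With \<open>S\<close> the square root of \<open>A\<close> and \<open>C = S\<inverse> B S\<inverse>\<close>, the claim reads \<open>S f(C) S \<ge> 0\<close> for a scalar
  function \<open>f\<close>, and the bounds put the spectrum of \<open>C\<close> on one side of 1, outside \<open>{1 / h<..<h}\<close>.
  For \<open>v \<le> 1/2\<close>, that \<open>f \<ge> 0\<close> there comes from the refined Young inequality with Kantorovich
  constant, which bounds \<open>Y = K powr k * a powr v * b powr (1 - v)\<close> from above, and from
  \<open>X + Y \<ge> 2 * sqrt (X * Y)\<close> for \<open>X = K powr (- k) * a powr (1 - v) * b powr v\<close>: the product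
  \<open>X * Y = a * b\<close> is free of \<open>K\<close>.

  The norm of \<open>p(A)\<close> is attained on the real spectrum without any resolvent calculus: for a
  symmetric \<open>T\<close> the operator \<open>T\<^sup>2 - \<parallel>T\<parallel>\<^sup>2\<close> is not bounded below, and factoring the real polynomial
  \<open>p\<^sup>2 - \<parallel>p(A)\<parallel>\<^sup>2\<close> leaves a real root \<open>t\<close> for which \<open>A - t\<close> is not bounded below, since the
  irreducible quadratic factors are coercive at \<open>A\<close>.
\<close>

subsection \<open>Polynomials of self-adjoint operators\<close>

lemma poly_op_eq_sum:
  assumes "degree p \<le> n"
  shows "poly_op p A = (\<Sum>i\<le>n. coeff p i *\<^sub>R ((blinfun_compose A) ^^ i) id_blinfun)"
  unfolding poly_op_def using assms
  by (intro sum.mono_neutral_left) (auto simp: coeff_eq_0)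

lemma poly_op_0 [simp]: "poly_op 0 A = 0"
  by (simp add: poly_op_def)

text \<open>Horner recursion. It lets multiplicativity and self-adjointness of
  \<open>poly_op\<close> go by induction over \<open>pCons\<close>.\<close>

lemma poly_op_pCons: "poly_op (pCons a p) A = a *\<^sub>R id_blinfun + (A o\<^sub>L poly_op p A)"
proof -
  have "poly_op (pCons a p) A =
      (\<Sum>i\<le>Suc (degree p). coeff (pCons a p) i *\<^sub>R ((blinfun_compose A) ^^ i) id_blinfun)"
    by (intro poly_op_eq_sum degree_pCons_le)
  also have "\<dots> = a *\<^sub>R id_blinfun
      + (\<Sum>i\<le>degree p. A o\<^sub>L (coeff p i *\<^sub>R ((blinfun_compose A) ^^ i) id_blinfun))"
    by (subst sum.atMost_Suc_shift)
      (simp add: bounded_bilinear.scaleR_right [OF bounded_bilinear_blinfun_compose])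
  also have "\<dots> = a *\<^sub>R id_blinfun + (A o\<^sub>L poly_op p A)"
    by (simp add: poly_op_def bounded_bilinear.sum_right [OF bounded_bilinear_blinfun_compose])
  finally show ?thesis .
qed

lemma poly_op_add: "poly_op (p + q) A = poly_op p A + poly_op q A"
proof -
  let ?n = "max (degree p) (degree q)"
  have "poly_op (p + q) A =
      (\<Sum>i\<le>?n. coeff (p + q) i *\<^sub>R ((blinfun_compose A) ^^ i) id_blinfun)"
    by (intro poly_op_eq_sum degree_add_le_max)
  then show ?thesis
    by (simp add: poly_op_eq_sum [of p ?n] poly_op_eq_sum [of q ?n] scaleR_add_left sum.distrib)
qed

lemma poly_op_smult: "poly_op (smult c p) A = c *\<^sub>R poly_op p A"
  using poly_op_eq_sum [of "smult c p" "degree p" A]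
  by (simp add: degree_smult_le poly_op_def scaleR_sum_right)

lemma poly_op_diff: "poly_op (p - q) A = poly_op p A - poly_op q A"
  using poly_op_add [of "p - q" q A] by simp

lemma blinfun_compose_assoc: "(R o\<^sub>L S) o\<^sub>L T = R o\<^sub>L (S o\<^sub>L T)"
  by (rule blinfun_eqI) simp

lemma blinfun_compose_id [simp]: "T o\<^sub>L id_blinfun = T" "id_blinfun o\<^sub>L T = T"
  by (rule blinfun_eqI, simp)+

lemma poly_op_mult: "poly_op (p * q) A = poly_op p A o\<^sub>L poly_op q A"
proof (induction p)
  case (pCons a p)
  then show ?case
    by (simp add: poly_op_add poly_op_smult poly_op_pCons blinfun_compose_assoc
        bounded_bilinear.add_left [OF bounded_bilinear_blinfun_compose]
        bounded_bilinear.scaleR_left [OF bounded_bilinear_blinfun_compose])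
qed simp

lemma poly_op_const [simp]: "poly_op [:a:] A = a *\<^sub>R id_blinfun"
  by (simp add: poly_op_pCons)

lemma poly_op_linear: "poly_op [:a, 1:] A = A + a *\<^sub>R id_blinfun"
  by (simp add: poly_op_pCons bounded_bilinear.scaleR_right [OF bounded_bilinear_blinfun_compose])

lemma poly_op_X [simp]: "poly_op [:0, 1:] A = A"
  by (simp add: poly_op_linear)

lemma poly_op_commute: "A o\<^sub>L poly_op p A = poly_op p A o\<^sub>L A"
  by (metis poly_op_X poly_op_mult mult.commute)

section \<open>Self-adjointness in terms of the real inner product\<close>

lemma Im_cinner: "Im (cinner x y) = inner x (\<i> *\<^sub>C y)"
proof -
  have "cinner x (\<i> *\<^sub>C y) = cnj (\<i> * cinner y x)"
    by (subst cinner_commute) (simp add: cinner_scaleC_left)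
  then show ?thesis
    using Re_cinner [of x "\<i> *\<^sub>C y"] by (subst cinner_commute) simp
qed

text \<open>The imaginary part of \<open>cinner\<close> is a real inner product with a vector
  multiplied by \<open>\<i>\<close>. So self-adjointness splits into symmetry for the real inner
  product and commutation with \<open>\<i>\<close>, and later estimates can stay real.\<close>

lemma selfadjoint_iff_inner:
  "selfadjoint T \<longleftrightarrow> (\<forall>x y. inner (T x) y = inner x (T y)) \<and> (\<forall>y. T (\<i> *\<^sub>C y) = \<i> *\<^sub>C T y)"
proof -
  have "selfadjoint T \<longleftrightarrow>
      (\<forall>x y. inner (T x) y = inner x (T y) \<and> inner (T x) (\<i> *\<^sub>C y) = inner x (\<i> *\<^sub>C T y))"
    by (simp add: selfadjoint_def complex_eq_iff Re_cinner Im_cinner)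
  also have "\<dots> \<longleftrightarrow>
      (\<forall>x y. inner (T x) y = inner x (T y)) \<and> (\<forall>y. T (\<i> *\<^sub>C y) = \<i> *\<^sub>C T y)"
    by (metis vector_eq_ldot)
  finally show ?thesis .
qed

lemma selfadjoint_inner: "selfadjoint T \<Longrightarrow> inner (T x) y = inner x (T y)"
  by (simp add: selfadjoint_iff_inner)

lemma scaleC_scaleR: "c *\<^sub>C (a *\<^sub>R x) = a *\<^sub>R (c *\<^sub>C x)"
  by (simp add: scaleC_of_real [symmetric] scaleC_scaleC mult.commute)

lemma selfadjoint_id: "selfadjoint id_blinfun"
  by (simp add: selfadjoint_def)

lemma selfadjoint_add: "selfadjoint S \<Longrightarrow> selfadjoint T \<Longrightarrow> selfadjoint (S + T)"
  by (simp add: selfadjoint_iff_inner blinfun.add_left inner_add_left inner_add_right scaleC_add_right)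

lemma selfadjoint_scaleR: "selfadjoint T \<Longrightarrow> selfadjoint (c *\<^sub>R T)"
  by (simp add: selfadjoint_iff_inner blinfun.scaleR_left scaleC_scaleR)

lemma selfadjoint_zero: "selfadjoint 0"
  using selfadjoint_scaleR [OF selfadjoint_id, of 0] by simp

lemma selfadjoint_commuting_compose:
  "selfadjoint S \<Longrightarrow> selfadjoint T \<Longrightarrow> S o\<^sub>L T = T o\<^sub>L S \<Longrightarrow> selfadjoint (S o\<^sub>L T)"
  unfolding selfadjoint_def by (metis blinfun_apply_blinfun_compose)

lemma selfadjoint_congruence:
  "selfadjoint S \<Longrightarrow> selfadjoint T \<Longrightarrow> selfadjoint (S o\<^sub>L T o\<^sub>L S)"
  unfolding selfadjoint_def by simp

lemma selfadjoint_poly_op: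
  assumes "selfadjoint A"
  shows "selfadjoint (poly_op p A)"
proof (induction p)
  case (pCons a p)
  then show ?case
    unfolding poly_op_pCons
    by (intro selfadjoint_add selfadjoint_scaleR selfadjoint_id selfadjoint_commuting_compose
        assms poly_op_commute)
qed (simp add: selfadjoint_zero)

text \<open>Both conditions of \<open>selfadjoint_iff_inner\<close> survive pointwise limits. This
  carries self-adjointness from polynomials to the functional calculus.\<close>

lemma selfadjoint_limit:
  assumes "T \<longlonglongrightarrow> L" and "\<And>n. selfadjoint (T n)"
  shows "selfadjoint L"
proof -
  have T: "(\<lambda>n. T n x) \<longlonglongrightarrow> L x" for x
    by (intro blinfun.tendsto assms tendsto_const)
  have iT: "(\<lambda>n. \<i> *\<^sub>C T n x) \<longlonglongrightarrow> \<i> *\<^sub>C L x" for x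
    by (intro bounded_linear.tendsto [OF bounded_linear_scaleC] T)
  have "inner (L x) y = inner x (L y)" for x y
  proof (rule LIMSEQ_unique)
    show "(\<lambda>n. inner (T n x) y) \<longlonglongrightarrow> inner (L x) y"
      by (intro tendsto_intros T)
    have "(\<lambda>n. inner x (T n y)) \<longlonglongrightarrow> inner x (L y)"
      by (intro tendsto_intros T)
    then show "(\<lambda>n. inner (T n x) y) \<longlonglongrightarrow> inner x (L y)"
      by (simp add: selfadjoint_inner [OF assms(2)])
  qed
  moreover have "L (\<i> *\<^sub>C y) = \<i> *\<^sub>C L y" for y
    by (rule LIMSEQ_unique [OF T]) (use iT assms(2) in \<open>simp add: selfadjoint_iff_inner\<close>)
  ultimately show ?thesis
    by (simp add: selfadjoint_iff_inner)
qed

text \<open>A substitute for invertibility that is stable under composition and needs no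
  surjectivity. Its failure for \<open>A - t\<close> means that \<open>t\<close> lies in the
  approximate point spectrum of \<open>A\<close>.\<close>

definition op_bounded_below :: "'a::complex_hilbert operator \<Rightarrow> bool"
  where "op_bounded_below T \<longleftrightarrow> (\<exists>c>0. \<forall>x. c * norm x \<le> norm (T x))"

lemma op_bounded_belowI: "0 < c \<Longrightarrow> (\<And>x. c * norm x \<le> norm (blinfun_apply T x)) \<Longrightarrow> op_bounded_below T"
  by (auto simp: op_bounded_below_def)

lemma op_bounded_below_compose:
  assumes "op_bounded_below S" "op_bounded_below T"
  shows "op_bounded_below (S o\<^sub>L T)"
proof -
  obtain c d where c: "0 < c" "\<And>x. c * norm x \<le> norm (S x)"
    and d: "0 < d" "\<And>x. d * norm x \<le> norm (T x)"
    using assms unfolding op_bounded_below_def by metis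
  have "(c * d) * norm x \<le> norm ((S o\<^sub>L T) x)" for x
  proof -
    have "c * (d * norm x) \<le> c * norm (T x)"
      using c(1) d(2) by simp
    also have "\<dots> \<le> norm (S (T x))"
      by (rule c(2))
    finally show ?thesis by simp
  qed
  with c(1) d(1) show ?thesis
    by (intro op_bounded_belowI [of "c * d"]) auto
qed

lemma invertible_imp_bounded_below:
  assumes "invertible_op T"
  shows "op_bounded_below T"
proof -
  obtain C where "C o\<^sub>L T = id_blinfun"
    using assms by (auto simp: invertible_op_def)
  then have C: "C (T x) = x" for x
    by (metis blinfun_apply_blinfun_compose blinfun_apply_id_blinfun)
  \<comment> \<open>The added 1 avoids a division by zero when \<open>C = 0\<close>, as happens on
    the trivial space.\<close>
  have "1 / (norm C + 1) * norm x \<le> norm (T x)" for x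
  proof -
    have "norm x \<le> norm C * norm (T x)"
      using norm_blinfun [of C "T x"] C by simp
    also have "\<dots> \<le> (norm C + 1) * norm (T x)"
      by (simp add: mult_right_mono)
    finally show ?thesis
      by (simp add: field_simps add_pos_nonneg add_nonneg_pos)
  qed
  then show ?thesis
    by (intro op_bounded_belowI [of "1 / (norm C + 1)"]) (auto simp: add_nonneg_pos)
qed

text \<open>The operator is the square of the self-adjoint \<open>A - a\<close> plus
  \<open>b\<^sup>2\<close>. Its quadratic form is therefore at least
  \<open>b\<^sup>2 * (norm x)\<^sup>2\<close>, and Cauchy-Schwarz turns this into a lower bound on
  the norm.\<close>

lemma bounded_below_quadratic:
  assumes A: "selfadjoint A" and b: "b \<noteq> 0"
  shows "op_bounded_below (poly_op [:a\<^sup>2 + b\<^sup>2, -2 * a, 1:] A)"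
proof (rule op_bounded_belowI [of "b\<^sup>2"])
  fix x
  let ?S = "A + (- a) *\<^sub>R id_blinfun" and ?T = "poly_op [:a\<^sup>2 + b\<^sup>2, -2 * a, 1:] A"
  have S: "selfadjoint ?S"
    by (intro selfadjoint_add selfadjoint_scaleR selfadjoint_id A)
  have "[:a\<^sup>2 + b\<^sup>2, -2 * a, 1:] = [:-a, 1:] * [:-a, 1:] + [:b\<^sup>2:]"
    by (simp add: power2_eq_square)
  then have "?T = (?S o\<^sub>L ?S) + b\<^sup>2 *\<^sub>R id_blinfun"
    by (simp only: poly_op_add poly_op_mult poly_op_linear poly_op_const)
  then have "inner (?T x) x = inner (?S (?S x)) x + b\<^sup>2 * (norm x)\<^sup>2"
    by (simp add: blinfun.add_left blinfun.scaleR_left inner_add_left power2_norm_eq_inner)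
  also have "inner (?S (?S x)) x = (norm (?S x))\<^sup>2"
    by (simp only: selfadjoint_inner [OF S] power2_norm_eq_inner)
  finally have "b\<^sup>2 * (norm x)\<^sup>2 \<le> inner (?T x) x"
    by simp
  also have "\<dots> \<le> norm (?T x) * norm x"
    by (rule norm_cauchy_schwarz)
  finally show "b\<^sup>2 * norm x \<le> norm (?T x)"
    by (cases "x = 0") (simp_all add: power2_eq_square mult.assoc [symmetric])
qed (use b in simp)

lemma poly_of_real_complex: "poly (map_poly of_real p) (of_real t :: complex) = of_real (poly p t)"
  by (induction p) (simp_all add: map_poly_pCons)

text \<open>The divisor is the real quadratic with roots \<open>z\<close> and \<open>cnj z\<close>.
  The remainder of \<open>p\<close> is a real polynomial of degree at most 1 that vanishes at the
  non-real \<open>z\<close>, which forces it to be 0.\<close>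

lemma nonreal_root_quadratic_dvd:
  fixes p :: "real poly" and z :: complex
  assumes root: "poly (map_poly of_real p) z = 0" and z: "Im z \<noteq> 0"
  shows "[:(Re z)\<^sup>2 + (Im z)\<^sup>2, - 2 * Re z, 1:] dvd p"
proof -
  let ?d = "[:(Re z)\<^sup>2 + (Im z)\<^sup>2, - 2 * Re z, 1:]"
  let ?c = "map_poly of_real :: real poly \<Rightarrow> complex poly"
  have add: "poly (?c (p + q)) z = poly (?c p) z + poly (?c q) z" for p q
    by (induction p q rule: poly_induct2) (simp_all add: map_poly_pCons algebra_simps)
  have smult: "poly (?c (smult a q)) z = of_real a * poly (?c q) z" for a q
    by (induction q) (simp_all add: map_poly_pCons algebra_simps)
  have mult: "poly (?c (p * q)) z = poly (?c p) z * poly (?c q) z" for p q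
    by (induction p) (simp_all add: map_poly_pCons add smult algebra_simps)
  have d: "poly (?c ?d) z = 0"
    by (simp add: map_poly_pCons complex_eq_iff power2_eq_square algebra_simps)
  have "poly (?c (p div ?d * ?d + p mod ?d)) z = 0"
    using root by (simp only: div_mult_mod_eq)
  then have rem: "poly (?c (p mod ?d)) z = 0"
    by (simp only: add mult d mult_zero_right add_0_left)
  have "degree (p mod ?d) < degree ?d \<or> p mod ?d = 0"
    using degree_mod_less [of ?d p] by auto
  then have "degree (p mod ?d) < 2"
    by auto
  then obtain a b where ab: "p mod ?d = [:a, b:]"
    by (cases "p mod ?d") (auto split: if_splits elim!: degree_eq_zeroE)
  with rem z show ?thesis
    by (auto simp: map_poly_pCons complex_eq_iff dvd_eq_mod_eq_0)
qed

text \<open>Strong induction on the degree: a complex root of \<open>q\<close> splits off a real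
  linear factor, bounded below by hypothesis, or a real quadratic one, bounded below by
  \<open>bounded_below_quadratic\<close>. Compositions preserve the property.\<close>

lemma bounded_below_poly_op:
  assumes A: "selfadjoint A" and "q \<noteq> 0"
    and "\<And>t. poly q t = 0 \<Longrightarrow> op_bounded_below (A - t *\<^sub>R id_blinfun)"
  shows "op_bounded_below (poly_op q A)"
  using assms(2,3)
proof (induction "degree q" arbitrary: q rule: less_induct)
  case less
  have step: "op_bounded_below (poly_op q A)"
    if d: "d dvd q" "0 < degree d" and bb: "op_bounded_below (poly_op d A)" for d
  proof -
    obtain s where s: "q = d * s"
      using d(1) by (elim dvdE)
    have "op_bounded_below (poly_op s A)"
      using less.prems d(2) by (intro less.hyps) (auto simp: s degree_mult_eq)
    with bb show ?thesis
      by (simp add: s poly_op_mult op_bounded_below_compose)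
  qed
  show ?case
  proof (cases "degree q = 0")
    case True
    then obtain a where a: "q = [:a:]"
      by (elim degree_eq_zeroE)
    then show ?thesis
      using less.prems(1) by (intro op_bounded_belowI [of "\<bar>a\<bar>"]) (auto simp: blinfun.scaleR_left)
  next
    case False
    have "\<not> constant (poly (map_poly of_real q :: complex poly))"
      using False by (simp add: constant_degree degree_map_poly)
    then obtain z where z: "poly (map_poly of_real q) z = (0::complex)"
      using fundamental_theorem_of_algebra by blast
    show ?thesis
    proof (cases "Im z = 0")
      case True
      then have "z = of_real (Re z)"
        by (simp add: complex_eq_iff)
      then have "poly q (Re z) = 0"
        using z poly_of_real_complex by (metis of_real_eq_0_iff)
      then show ?thesis
        using less.prems(2) [of "Re z"]
        by (intro step [of "[:- Re z, 1:]"]) (simp_all add: poly_eq_0_iff_dvd poly_op_linear)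
    next
      case False
      then show ?thesis
        using z by (intro step [OF nonreal_root_quadratic_dvd] bounded_below_quadratic A) auto
    qed
  qed
qed

section \<open>The real spectrum and the norm of a polynomial\<close>

abbreviation real_spectrum :: "'a::complex_hilbert operator \<Rightarrow> real set"
  where "real_spectrum A \<equiv> {t. complex_of_real t \<in> op_spectrum A}"

lemma scalar_op_of_real: "scalar_op (of_real t) = t *\<^sub>R id_blinfun"
proof (rule blinfun_eqI)
  fix x
  have "scalar_op (of_real t) x = of_real t *\<^sub>C x"
    unfolding scalar_op_def by (subst bounded_linear_Blinfun_apply [OF bounded_linear_scaleC]) simp
  then show "scalar_op (of_real t) x = (t *\<^sub>R id_blinfun) x"
    by (simp add: scaleC_of_real blinfun.scaleR_left)
qed

lemma real_spectrum_iff: "t \<in> real_spectrum A \<longleftrightarrow> \<not> invertible_op (A - t *\<^sub>R id_blinfun)"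
  by (simp add: op_spectrum_def scalar_op_of_real)

text \<open>Expanding the square of \<open>norm (T (T x) - ?N\<^sup>2 *\<^sub>R x)\<close> under a
  lower bound with constant \<open>c\<close> would give the operator \<open>T\<close> a norm
  strictly smaller than \<open>?N\<close>.\<close>

lemma not_bounded_below_norm:
  assumes T: "selfadjoint T" and N: "0 < norm T"
  shows "\<not> op_bounded_below ((T o\<^sub>L T) - (norm T)\<^sup>2 *\<^sub>R id_blinfun)"
proof
  let ?N = "norm T"
  assume "op_bounded_below ((T o\<^sub>L T) - ?N\<^sup>2 *\<^sub>R id_blinfun)"
  then obtain c where c: "0 < c" "\<And>x. c * norm x \<le> norm (T (T x) - ?N\<^sup>2 *\<^sub>R x)"
    by (auto simp: op_bounded_below_def blinfun.diff_left blinfun.scaleR_left)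
  \<comment> \<open>The improved bound for the square of the norm, cut off at 0 so that its square
    root squares back to it.\<close>
  let ?K = "max 0 (?N\<^sup>2 - c\<^sup>2 / ?N\<^sup>2)"
  have "norm (T x) \<le> sqrt ?K * norm x" for x
  proof -
    have "(c * norm x)\<^sup>2 \<le> (norm (T (T x) - ?N\<^sup>2 *\<^sub>R x))\<^sup>2"
      using c by (intro power_mono) auto
    also have "\<dots> = (norm (T (T x)))\<^sup>2 - 2 * ?N\<^sup>2 * inner (T (T x)) x + ?N\<^sup>2 * ?N\<^sup>2 * (norm x)\<^sup>2"
      by (simp add: power2_norm_eq_inner inner_diff_left inner_diff_right inner_commute algebra_simps)
    also have "inner (T (T x)) x = (norm (T x))\<^sup>2"
      by (simp add: selfadjoint_inner [OF T] power2_norm_eq_inner)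
    also have "(norm (T (T x)))\<^sup>2 \<le> (?N * norm (T x))\<^sup>2"
      by (intro power_mono norm_blinfun) auto
    finally have "c\<^sup>2 * (norm x)\<^sup>2 + ?N\<^sup>2 * (norm (T x))\<^sup>2 \<le> ?N\<^sup>2 * ?N\<^sup>2 * (norm x)\<^sup>2"
      by (simp add: power_mult_distrib)
    moreover have "?N\<^sup>2 * ((?N\<^sup>2 - c\<^sup>2 / ?N\<^sup>2) * (norm x)\<^sup>2)
        = ?N\<^sup>2 * ?N\<^sup>2 * (norm x)\<^sup>2 - c\<^sup>2 * (norm x)\<^sup>2"
      using N by (simp add: field_simps)
    ultimately have "?N\<^sup>2 * (norm (T x))\<^sup>2 \<le> ?N\<^sup>2 * ((?N\<^sup>2 - c\<^sup>2 / ?N\<^sup>2) * (norm x)\<^sup>2)"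
      by linarith
    then have "(norm (T x))\<^sup>2 \<le> (?N\<^sup>2 - c\<^sup>2 / ?N\<^sup>2) * (norm x)\<^sup>2"
      using N by simp
    also have "\<dots> \<le> ?K * (norm x)\<^sup>2"
      by (intro mult_right_mono) auto
    also have "\<dots> = (sqrt ?K * norm x)\<^sup>2"
      by (simp add: power_mult_distrib)
    finally show ?thesis
      by (rule power2_le_imp_le) simp
  qed
  then have "?N \<le> sqrt ?K"
    by (intro norm_blinfun_bound) auto
  then have "?N\<^sup>2 \<le> (sqrt ?K)\<^sup>2"
    by (intro power_mono) auto
  moreover have "?K < ?N\<^sup>2"
    using N c(1) by simp
  ultimately show False
    by simp
qed

lemma norm_poly_op_spectral_value:
  assumes A: "selfadjoint A" and N: "0 < norm (poly_op p A)" and p: "0 < degree p"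
  obtains t where "t \<in> real_spectrum A" "\<bar>poly p t\<bar> = norm (poly_op p A)"
proof -
  let ?N = "norm (poly_op p A)" and ?q = "p * p - [:(norm (poly_op p A))\<^sup>2:]"
  have q: "poly_op ?q A = (poly_op p A o\<^sub>L poly_op p A) - ?N\<^sup>2 *\<^sub>R id_blinfun"
    by (simp add: poly_op_diff poly_op_mult)
  \<comment> \<open>Since \<open>p\<close> is not constant, \<open>p * p\<close> has positive degree
    and cannot cancel against a constant.\<close>
  have "?q \<noteq> 0"
  proof
    assume "?q = 0"
    then have "p * p = [:(norm (poly_op p A))\<^sup>2:]"
      by simp
    then have "degree (p * p) = 0"
      by (metis degree_pCons_0)
    moreover have "degree (p * p) = degree p + degree p"
      using p by (intro degree_mult_eq) auto
    ultimately show False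
      using p by simp
  qed
  moreover have "\<not> op_bounded_below (poly_op ?q A)"
    unfolding q using N by (intro not_bounded_below_norm selfadjoint_poly_op A)
  ultimately obtain t where t: "poly ?q t = 0" "\<not> op_bounded_below (A - t *\<^sub>R id_blinfun)"
    using bounded_below_poly_op [OF A] by blast
  have "t \<in> real_spectrum A"
    using t(2) invertible_imp_bounded_below unfolding real_spectrum_iff by blast
  moreover have "(poly p t)\<^sup>2 = ?N\<^sup>2"
    using t(1) by (simp add: power2_eq_square)
  then have "\<bar>poly p t\<bar> = ?N"
    using power2_eq_iff_nonneg [of "\<bar>poly p t\<bar>" ?N] by simp
  ultimately show ?thesis
    by (rule that)
qed

lemma norm_poly_op_le:
  assumes A: "selfadjoint A" and e: "0 \<le> e"
    and bound: "\<And>t. t \<in> real_spectrum A \<Longrightarrow> \<bar>poly p t\<bar> \<le> e"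
  shows "norm (poly_op p A) \<le> e"
proof (cases "norm (poly_op p A) = 0")
  case False
  then have N: "0 < norm (poly_op p A)"
    by simp
  show ?thesis
  proof (cases "degree p = 0")
    case True
    then obtain a where a: "p = [:a:]"
      by (elim degree_eq_zeroE)
    have nz: "norm (id_blinfun :: 'a operator) \<noteq> 0"
      using N a by auto
    \<comment> \<open>For constant \<open>p\<close> the bound is informative only if the real
      spectrum is nonempty. A spectral point is obtained from a polynomial of degree 1 whose value
      at \<open>A\<close> is nonzero.\<close>
    obtain s where s: "norm (poly_op [:s, 1:] A) \<noteq> 0"
    proof (cases "A = 0")
      case True
      with nz show ?thesis
        by (intro that [of 1]) (simp add: poly_op_linear)
    qed (auto intro: that [of 0])
    then obtain t where "t \<in> real_spectrum A"
      using norm_poly_op_spectral_value [OF A, of "[:s, 1:]"] by auto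
    then have "\<bar>a\<bar> \<le> e"
      using bound a by simp
    moreover have "norm (id_blinfun :: 'a operator) \<le> 1"
      by (intro norm_blinfun_bound) auto
    ultimately show ?thesis
      using a mult_mono [of "\<bar>a\<bar>" e "norm (id_blinfun :: 'a operator)" 1] e by simp
  next
    case False
    then have "0 < degree p"
      by simp
    then obtain t where "t \<in> real_spectrum A" "\<bar>poly p t\<bar> = norm (poly_op p A)"
      using norm_poly_op_spectral_value [OF A N] by blast
    then show ?thesis
      using bound [of t] by simp
  qed
qed (use e in simp)

subsection \<open>Functional calculus on an interval\<close>

text \<open>Lax-Milgram by Banach's fixed point theorem: for small \<open>e > 0\<close> the map
  sending \<open>x\<close> to \<open>x - e *\<^sub>R T x + e *\<^sub>R y\<close> is a contraction,
  and its fixed point solves \<open>T x = y\<close>. The lower bound gives injectivity and a bounded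
  inverse.\<close>

lemma coercive_imp_invertible:
  fixes T :: "'a::complex_hilbert operator"
  assumes c: "0 < c" and T: "\<And>x. c * (norm x)\<^sup>2 \<le> inner (T x) x"
  shows "invertible_op T"
proof -
  have below: "c * norm x \<le> norm (T x)" for x
  proof -
    have "c * (norm x)\<^sup>2 \<le> norm (T x) * norm x"
      using T norm_cauchy_schwarz by (rule order_trans)
    then show ?thesis
      by (cases "x = 0") (simp_all add: power2_eq_square mult.assoc [symmetric])
  qed
  \<comment> \<open>Adding \<open>c\<close> to the norm yields \<open>0 < N\<close> and
    \<open>c \<le> N\<close> at once; the latter makes \<open>q\<close> nonnegative.\<close>
  define N where "N = norm T + c"
  have N: "0 < N" "c \<le> N"
    using c by (simp_all add: N_def add_nonneg_pos)
  \<comment> \<open>This \<open>e\<close> minimises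
    \<open>1 - 2 * e * c + e\<^sup>2 * N\<^sup>2\<close>, and \<open>q\<close> is the
    minimum.\<close>
  define e where "e = c / N\<^sup>2"
  define q where "q = 1 - c\<^sup>2 / N\<^sup>2"
  have e: "0 < e"
    using c N by (simp add: e_def)
  have q: "0 \<le> q" "q < 1"
    using c N power_mono [of c N 2] by (simp_all add: q_def)
  have contraction: "(norm (x - e *\<^sub>R T x))\<^sup>2 \<le> q * (norm x)\<^sup>2" for x
  proof -
    have "norm (T x) \<le> N * norm x"
      using norm_blinfun [of T x] c by (simp add: N_def distrib_right add_increasing2)
    then have TN: "(norm (T x))\<^sup>2 \<le> N\<^sup>2 * (norm x)\<^sup>2"
      by (metis norm_ge_zero power_mono power_mult_distrib)
    have "(norm (x - e *\<^sub>R T x))\<^sup>2 = (norm x)\<^sup>2 - 2 * e * inner (T x) x + e\<^sup>2 * (norm (T x))\<^sup>2"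
      by (simp add: power2_norm_eq_inner inner_diff_left inner_diff_right inner_commute
          power2_eq_square [of e] algebra_simps)
    also have "\<dots> \<le> (norm x)\<^sup>2 - 2 * e * (c * (norm x)\<^sup>2) + e\<^sup>2 * (N\<^sup>2 * (norm x)\<^sup>2)"
      using e by (intro add_mono diff_mono mult_left_mono T TN) auto
    also have "\<dots> = q * (norm x)\<^sup>2"
      using N by (simp add: e_def q_def field_simps power2_eq_square)
    finally show ?thesis .
  qed
  have "\<exists>x. T x = y" for y
  proof -
    let ?f = "\<lambda>x. x - e *\<^sub>R T x + e *\<^sub>R y"
    have "dist (?f x) (?f z) \<le> sqrt q * dist x z" for x z
    proof -
      have "dist (?f x) (?f z) = norm ((x - z) - e *\<^sub>R T (x - z))"
        by (simp add: dist_norm blinfun.diff_right algebra_simps)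
      also have "\<dots> \<le> sqrt (q * (norm (x - z))\<^sup>2)"
        by (rule real_le_rsqrt [OF contraction])
      finally show ?thesis
        by (simp add: real_sqrt_mult dist_norm)
    qed
    then obtain x where "?f x = x"
      using banach_fix_type [of "sqrt q" ?f] q by auto
    moreover have "e *\<^sub>R (y - T x) = ?f x - x"
      by (simp add: scaleR_diff_right)
    ultimately have "e *\<^sub>R (y - T x) = 0"
      by simp
    with e have "T x = y"
      by auto
    then show ?thesis ..
  qed
  then obtain g where Tg: "T (g y) = y" for y
    by metis
  have inj: "x = y" if "T x = T y" for x y
    using below [of "x - y"] that c by (simp add: blinfun.diff_right mult_le_0_iff)
  have "bounded_linear g"
  proof (rule bounded_linear_intro)
    show "g (x + y) = g x + g y" for x y
      by (rule inj) (simp add: Tg blinfun.add_right)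
    show "g (r *\<^sub>R x) = r *\<^sub>R g x" for r x
      by (rule inj) (simp add: Tg blinfun.scaleR_right)
    show "norm (g x) \<le> norm x * (1 / c)" for x
      using below [of "g x"] c by (simp add: Tg field_simps)
  qed
  then have g: "blinfun_apply (Blinfun g) = g"
    by (rule bounded_linear_Blinfun_apply)
  have "T o\<^sub>L Blinfun g = id_blinfun"
    by (rule blinfun_eqI) (simp add: g Tg)
  moreover have "Blinfun g o\<^sub>L T = id_blinfun"
    by (rule blinfun_eqI, rule inj) (simp add: g Tg)
  ultimately show ?thesis
    by (auto simp: invertible_op_def)
qed

lemma invertible_op_uminus: "invertible_op (- T) \<Longrightarrow> invertible_op T"
proof -
  assume "invertible_op (- T)"
  then obtain C where "(- T) o\<^sub>L C = id_blinfun" "C o\<^sub>L (- T) = id_blinfun"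
    by (auto simp: invertible_op_def)
  then have "T o\<^sub>L (- C) = id_blinfun" "(- C) o\<^sub>L T = id_blinfun"
    by (simp_all add: bounded_bilinear.minus_left [OF bounded_bilinear_blinfun_compose]
        bounded_bilinear.minus_right [OF bounded_bilinear_blinfun_compose])
  then show "invertible_op T"
    by (auto simp: invertible_op_def)
qed

lemma polynomial_approximation:
  fixes f :: "real \<Rightarrow> real"
  assumes "continuous_on {c..d} f"
  obtains p where "uniform_limit {c..d} (\<lambda>n. poly (p n)) f sequentially"
proof -
  have "\<exists>p. \<forall>t\<in>{c..d}. \<bar>f t - poly p t\<bar> < inverse (of_nat (Suc n))" for n
  proof -
    obtain g where g: "real_polynomial_function g"
      "\<And>t. t \<in> {c..d} \<Longrightarrow> \<bar>f t - g t\<bar> < inverse (of_nat (Suc n))"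
      using Stone_Weierstrass_real_polynomial_function [OF _ assms, of "inverse (of_nat (Suc n))"]
      by auto
    then obtain a k where "g = (\<lambda>x. \<Sum>i\<le>k. a i * x ^ i)"
      using real_polynomial_function_iff_sum by auto
    then have "g t = poly (\<Sum>i\<le>k. monom (a i) i) t" for t
      by (simp add: poly_sum poly_monom)
    with g(2) show ?thesis
      by metis
  qed
  then obtain p where p: "\<And>n t. t \<in> {c..d} \<Longrightarrow> \<bar>f t - poly (p n) t\<bar> < inverse (of_nat (Suc n))"
    by metis
  have "uniform_limit {c..d} (\<lambda>n. poly (p n)) f sequentially"
  proof (rule uniform_limitI)
    fix e :: real
    assume "0 < e"
    then obtain N where N: "inverse (of_nat (Suc N)) < e"
      using reals_Archimedean by blast
    have "dist (poly (p n) t) (f t) < e" if "N \<le> n" "t \<in> {c..d}" for n t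
    proof -
      have "inverse (of_nat (Suc n)) \<le> (inverse (of_nat (Suc N)) :: real)"
        using that(1) by (intro le_imp_inverse_le) auto
      then have "\<bar>f t - poly (p n) t\<bar> < e"
        using p [OF that(2), of n] N by linarith
      then show ?thesis
        by (simp add: dist_real_def abs_minus_commute)
    qed
    then show "\<forall>\<^sub>F n in sequentially. \<forall>t\<in>{c..d}. dist (poly (p n) t) (f t) < e"
      unfolding eventually_sequentially by blast
  qed
  then show ?thesis
    by (rule that)
qed

text \<open>The quadratic form bounds confine the real spectrum to \<open>{c..d}\<close>. Continuity
  and approximation can then be handled on a compact interval instead of on the spectrum
  itself.\<close>

locale bounded_selfadjoint =
  fixes A :: "'a::complex_hilbert operator" and c d :: real
  assumes selfadjoint: "selfadjoint A"
    and lower: "\<And>x. c * (norm x)\<^sup>2 \<le> inner (A x) x"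
    and upper: "\<And>x. inner (A x) x \<le> d * (norm x)\<^sup>2"
begin

text \<open>For \<open>t < c\<close> the operator \<open>A - t\<close> is coercive, and for
  \<open>t > d\<close> its negative is.\<close>

lemma real_spectrum_subset: "real_spectrum A \<subseteq> {c..d}"
proof
  fix t
  assume t: "t \<in> real_spectrum A"
  have "c \<le> t"
  proof (rule ccontr)
    assume "\<not> c \<le> t"
    then have "invertible_op (A - t *\<^sub>R id_blinfun)"
      using lower by (intro coercive_imp_invertible [of "c - t"])
        (simp_all add: blinfun.diff_left blinfun.scaleR_left inner_diff_left power2_norm_eq_inner
          left_diff_distrib)
    with t show False
      unfolding real_spectrum_iff by blast
  qed
  moreover have "t \<le> d"
  proof (rule ccontr)
    assume "\<not> t \<le> d"
    then have "invertible_op (- (A - t *\<^sub>R id_blinfun))"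
      using upper by (intro coercive_imp_invertible [of "t - d"])
        (simp_all add: blinfun.diff_left blinfun.scaleR_left inner_diff_left power2_norm_eq_inner
          left_diff_distrib)
    with t show False
      unfolding real_spectrum_iff using invertible_op_uminus by blast
  qed
  ultimately show "t \<in> {c..d}"
    by simp
qed

lemma norm_poly_op_diff_le:
  assumes "0 \<le> e" "\<And>t. t \<in> real_spectrum A \<Longrightarrow> dist (poly p t) (poly q t) \<le> e"
  shows "dist (poly_op p A) (poly_op q A) \<le> e"
  unfolding dist_norm poly_op_diff [symmetric]
  using assms(2) by (intro norm_poly_op_le selfadjoint assms(1)) (simp add: dist_real_def)

text \<open>Justifies the description operator in \<open>fun_calc\<close>: by
  \<open>norm_poly_op_diff_le\<close>, polynomials that are uniformly close on the spectrum have
  close values at \<open>A\<close>. So the values along \<open>p\<close> form a Cauchy sequence, and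
  every other approximating sequence has the same limit.\<close>

lemma fun_calc_limit:
  assumes f: "continuous_on {c..d} f"
    and p: "uniform_limit {c..d} (\<lambda>n. poly (p n)) f sequentially"
  shows "(\<lambda>n. poly_op (p n) A) \<longlonglongrightarrow> fun_calc f A"
proof -
  let ?\<sigma> = "real_spectrum A"
  have p': "uniform_limit ?\<sigma> (\<lambda>n. poly (p n)) f sequentially"
    using p real_spectrum_subset by (rule uniform_limit_on_subset)
  have "Cauchy (\<lambda>n. poly_op (p n) A)"
  proof (rule metric_CauchyI)
    fix e :: real
    assume e: "0 < e"
    obtain N where N: "\<And>n t. N \<le> n \<Longrightarrow> t \<in> ?\<sigma> \<Longrightarrow> dist (poly (p n) t) (f t) < e / 4"
      using uniform_limitD [OF p', of "e / 4"] e unfolding eventually_sequentially by auto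
    have dist: "dist (poly_op (p m) A) (poly_op (p n) A) \<le> e / 2" if "N \<le> m" "N \<le> n" for m n
    proof (rule norm_poly_op_diff_le)
      fix t assume t: "t \<in> ?\<sigma>"
      show "dist (poly (p m) t) (poly (p n) t) \<le> e / 2"
        using dist_triangle2 [of "poly (p m) t" "poly (p n) t" "f t"] N [OF that(1) t] N [OF that(2) t]
        by linarith
    qed (use e in simp)
    show "\<exists>N. \<forall>m\<ge>N. \<forall>n\<ge>N. dist (poly_op (p m) A) (poly_op (p n) A) < e"
    proof (intro exI allI impI)
      fix m n
      assume "N \<le> m" "N \<le> n"
      then show "dist (poly_op (p m) A) (poly_op (p n) A) < e"
        using dist [of m n] e by linarith
    qed
  qed
  then obtain T where T: "(\<lambda>n. poly_op (p n) A) \<longlonglongrightarrow> T"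
    using Cauchy_convergent convergent_def by blast
  have limit: "(\<lambda>n. poly_op (q n) A) \<longlonglongrightarrow> T"
    if q: "uniform_limit ?\<sigma> (\<lambda>n. poly (q n)) f sequentially" for q
  proof -
    have "(\<lambda>n. dist (poly_op (q n) A) (poly_op (p n) A)) \<longlonglongrightarrow> 0"
    proof (rule tendstoI)
      fix e :: real
      assume e: "0 < e"
      have "\<forall>\<^sub>F n in sequentially. \<forall>t\<in>?\<sigma>. dist (poly (p n) t) (f t) < e / 4"
        and "\<forall>\<^sub>F n in sequentially. \<forall>t\<in>?\<sigma>. dist (poly (q n) t) (f t) < e / 4"
        using uniform_limitD [OF p', of "e / 4"] uniform_limitD [OF q, of "e / 4"] e by auto
      then show "\<forall>\<^sub>F n in sequentially. dist (dist (poly_op (q n) A) (poly_op (p n) A)) 0 < e"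
      proof eventually_elim
        case (elim n)
        have "dist (poly_op (q n) A) (poly_op (p n) A) \<le> e / 2"
        proof (rule norm_poly_op_diff_le)
          fix t assume t: "t \<in> ?\<sigma>"
          show "dist (poly (q n) t) (poly (p n) t) \<le> e / 2"
            using dist_triangle2 [of "poly (q n) t" "poly (p n) t" "f t"]
              bspec [OF elim(1) t] bspec [OF elim(2) t] by linarith
        qed (use e in simp)
        with e show ?case
          by simp
      qed
    qed
    then show ?thesis
      using tendsto_add [OF tendsto_norm_zero_cancel T, of "\<lambda>n. poly_op (q n) A - poly_op (p n) A"]
      by (simp add: dist_norm)
  qed
  \<comment> \<open>Uniqueness relies on the existence of an approximating sequence, here
    \<open>p\<close>; otherwise every \<open>S\<close> would satisfy the description
    vacuously.\<close>
  have "fun_calc f A = T"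
    unfolding fun_calc_def
  proof (rule the_equality)
    fix S
    assume "\<forall>p. uniform_limit ?\<sigma> (\<lambda>n. poly (p n)) f sequentially \<longrightarrow> (\<lambda>n. poly_op (p n) A) \<longlonglongrightarrow> S"
    with p' have "(\<lambda>n. poly_op (p n) A) \<longlonglongrightarrow> S"
      by blast
    then show "S = T"
      using T by (rule LIMSEQ_unique)
  qed (use limit in blast)
  with T show ?thesis
    by simp
qed

text \<open>One convenient approximating sequence determines the value. The algebraic rules below
  combine sequences for \<open>f\<close> and \<open>g\<close>.\<close>

lemma fun_calc_eqI:
  assumes "continuous_on {c..d} f"
    and "uniform_limit {c..d} (\<lambda>n. poly (p n)) f sequentially"
    and "(\<lambda>n. poly_op (p n) A) \<longlonglongrightarrow> T"
  shows "fun_calc f A = T"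
  using fun_calc_limit [OF assms(1,2)] assms(3) by (rule LIMSEQ_unique)

lemma fun_calc_const: "fun_calc (\<lambda>_. a) A = a *\<^sub>R id_blinfun"
  by (rule fun_calc_eqI [where p = "\<lambda>_. [:a:]"]) (auto simp: uniform_limit_iff)

lemma fun_calc_ident: "fun_calc (\<lambda>t. t) A = A"
  by (rule fun_calc_eqI [where p = "\<lambda>_. [:0, 1:]"])
    (auto simp: uniform_limit_iff intro: continuous_on_id)

lemma fun_calc_mult:
  assumes f: "continuous_on {c..d} f" and g: "continuous_on {c..d} g"
  shows "fun_calc (\<lambda>t. f t * g t) A = fun_calc f A o\<^sub>L fun_calc g A"
proof -
  obtain p q where p: "uniform_limit {c..d} (\<lambda>n. poly (p n)) f sequentially"
    and q: "uniform_limit {c..d} (\<lambda>n. poly (q n)) g sequentially"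
    using polynomial_approximation f g by metis
  show ?thesis
  proof (rule fun_calc_eqI [where p = "\<lambda>n. p n * q n"])
    \<comment> \<open>Uniform convergence of products needs bounded limits, which compactness of the
      interval supplies.\<close>
    show "uniform_limit {c..d} (\<lambda>n. poly (p n * q n)) (\<lambda>t. f t * g t) sequentially"
      unfolding poly_mult
      by (intro uniform_lim_mult p q compact_imp_bounded compact_continuous_image f g) auto
    show "(\<lambda>n. poly_op (p n * q n) A) \<longlonglongrightarrow> (fun_calc f A o\<^sub>L fun_calc g A)"
      unfolding poly_op_mult
      by (intro bounded_bilinear.tendsto [OF bounded_bilinear_blinfun_compose]
          fun_calc_limit f g p q)
  qed (intro continuous_intros f g)
qed

lemma fun_calc_add:
  assumes f: "continuous_on {c..d} f" and g: "continuous_on {c..d} g"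
  shows "fun_calc (\<lambda>t. f t + g t) A = fun_calc f A + fun_calc g A"
proof -
  obtain p q where p: "uniform_limit {c..d} (\<lambda>n. poly (p n)) f sequentially"
    and q: "uniform_limit {c..d} (\<lambda>n. poly (q n)) g sequentially"
    using polynomial_approximation f g by metis
  show ?thesis
  proof (rule fun_calc_eqI [where p = "\<lambda>n. p n + q n"])
    show "uniform_limit {c..d} (\<lambda>n. poly (p n + q n)) (\<lambda>t. f t + g t) sequentially"
      unfolding poly_add by (intro uniform_limit_add p q)
    show "(\<lambda>n. poly_op (p n + q n) A) \<longlonglongrightarrow> fun_calc f A + fun_calc g A"
      unfolding poly_op_add by (intro tendsto_add fun_calc_limit f g p q)
  qed (intro continuous_intros f g)
qed

lemma fun_calc_scaleR:
  assumes "continuous_on {c..d} f"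
  shows "fun_calc (\<lambda>t. a * f t) A = a *\<^sub>R fun_calc f A"
  using fun_calc_mult [OF continuous_on_const assms, of a]
  by (simp add: fun_calc_const bounded_bilinear.scaleR_left [OF bounded_bilinear_blinfun_compose])

lemma fun_calc_diff:
  assumes "continuous_on {c..d} f" "continuous_on {c..d} g"
  shows "fun_calc (\<lambda>t. f t - g t) A = fun_calc f A - fun_calc g A"
  using fun_calc_add [OF assms(1), of "\<lambda>t. -1 * g t"] fun_calc_scaleR [OF assms(2), of "-1"] assms(2)
  by (simp add: continuous_on_minus)

text \<open>The description in \<open>fun_calc\<close> sees only values on the spectrum, which lies
  inside \<open>{c..d}\<close>.\<close>

lemma fun_calc_cong:
  assumes "\<And>t. t \<in> {c..d} \<Longrightarrow> f t = g t"
  shows "fun_calc f A = fun_calc g A"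
proof -
  have "uniform_limit (real_spectrum A) p f sequentially \<longleftrightarrow>
      uniform_limit (real_spectrum A) p g sequentially" for p
    using real_spectrum_subset assms by (intro uniform_limit_cong') auto
  then show ?thesis
    unfolding fun_calc_def by simp
qed

lemma selfadjoint_fun_calc:
  assumes "continuous_on {c..d} f"
  shows "selfadjoint (fun_calc f A)"
proof -
  obtain p where "uniform_limit {c..d} (\<lambda>n. poly (p n)) f sequentially"
    using polynomial_approximation assms by metis
  then show ?thesis
    using fun_calc_limit [OF assms] selfadjoint_poly_op [OF selfadjoint]
    by (blast intro: selfadjoint_limit)
qed

text \<open>Writing \<open>f\<close> as the square of \<open>sqrt (f t)\<close> makes
  \<open>fun_calc f A\<close> the square of a self-adjoint operator.\<close>

lemma positive_fun_calc:
  assumes f: "continuous_on {c..d} f" and nonneg: "\<And>t. t \<in> {c..d} \<Longrightarrow> 0 \<le> f t"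
  shows "positive_op (fun_calc f A)"
proof -
  let ?S = "fun_calc (\<lambda>t. sqrt (f t)) A"
  have s: "continuous_on {c..d} (\<lambda>t. sqrt (f t))"
    by (intro continuous_intros f)
  have "fun_calc f A = fun_calc (\<lambda>t. sqrt (f t) * sqrt (f t)) A"
    using nonneg by (intro fun_calc_cong) simp
  also have "\<dots> = ?S o\<^sub>L ?S"
    by (rule fun_calc_mult [OF s s])
  finally have "inner (fun_calc f A x) x = (norm (?S x))\<^sup>2" for x
    by (simp add: selfadjoint_inner [OF selfadjoint_fun_calc [OF s]] power2_norm_eq_inner)
  then show ?thesis
    by (simp add: positive_op_def selfadjoint_fun_calc [OF f] Re_cinner)
qed

section \<open>Real powers of a positive operator\<close>

lemma continuous_on_powr:
  assumes "0 < c"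
  shows "continuous_on {c..d} (\<lambda>t. t powr s)"
  using assms by (intro continuous_intros) auto

lemma op_powr_add:
  assumes "0 < c"
  shows "op_powr A s o\<^sub>L op_powr A t = op_powr A (s + t)"
  unfolding op_powr_def
  using fun_calc_mult [OF continuous_on_powr continuous_on_powr, of s t] assms
  by (simp add: powr_add)

lemma op_powr_zero:
  assumes "0 < c"
  shows "op_powr A 0 = id_blinfun"
proof -
  \<comment> \<open>Positivity of \<open>c\<close> matters: \<open>t powr 0\<close> is 1 only for
    nonzero \<open>t\<close>.\<close>
  have "op_powr A 0 = fun_calc (\<lambda>_. 1) A"
    unfolding op_powr_def using assms by (intro fun_calc_cong) auto
  then show ?thesis
    by (simp add: fun_calc_const)
qed

lemma op_powr_one:
  assumes "0 < c"
  shows "op_powr A 1 = A"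
proof -
  have "op_powr A 1 = fun_calc (\<lambda>t. t) A"
    unfolding op_powr_def using assms by (intro fun_calc_cong) auto
  then show ?thesis
    by (simp add: fun_calc_ident)
qed

lemma selfadjoint_op_powr: "0 < c \<Longrightarrow> selfadjoint (op_powr A s)"
  unfolding op_powr_def by (intro selfadjoint_fun_calc continuous_on_powr)

end

subsection \<open>Young inequalities with Kantorovich constant\<close>

lemma kantorovich2_inverse: "0 < t \<Longrightarrow> kantorovich2 (1 / t) = kantorovich2 t"
  by (simp add: kantorovich2_def field_simps power2_eq_square)

lemma kantorovich2_ge_1: "0 < t \<Longrightarrow> 1 \<le> kantorovich2 t"
  using zero_le_power2 [of "t - 1"] by (simp add: kantorovich2_def field_simps power2_eq_square)

lemma kantorovich2_mono:
  assumes "1 \<le> s" "s \<le> t"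
  shows "kantorovich2 s \<le> kantorovich2 t"
proof -
  \<comment> \<open>Up to the positive factor \<open>4 * s * t\<close>, this product is the
    difference of the two Kantorovich constants.\<close>
  have "0 \<le> (t - s) * (s * t - 1)"
    using assms mult_mono [of 1 s 1 t] by (intro mult_nonneg_nonneg) auto
  then show ?thesis
    using assms by (simp add: kantorovich2_def field_simps power2_eq_square)
qed

lemma weighted_am_gm:
  fixes x y w :: real
  assumes "0 < x" "0 < y" "0 \<le> w" "w \<le> 1"
  shows "x powr (1 - w) * y powr w \<le> (1 - w) * x + w * y"
  using Youngs_inequality_0 [of "1 - w" w x y] assms by simp

text \<open>Since \<open>kantorovich2 z * z\<close> is the square of \<open>(1 + z) / 2\<close>, the
  left side is the power \<open>2 * l\<close> of that mean. Weighted AM-GM between 1 and the mean,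
  with weight \<open>2 * l \<le> 1\<close>, finishes.\<close>

lemma young_kantorovich_half:
  fixes l z :: real
  assumes z: "0 < z" and l: "0 \<le> l" "l \<le> 1/2"
  shows "kantorovich2 z powr l * z powr l \<le> (1 - l) + l * z"
proof -
  have "kantorovich2 z * z = ((1 + z) / 2) powr 2"
    using z by (simp add: kantorovich2_def powr_numeral power2_eq_square field_simps)
  then have "(kantorovich2 z * z) powr l = ((1 + z) / 2) powr (2 * l)"
    by (simp only: powr_powr)
  then have "kantorovich2 z powr l * z powr l = ((1 + z) / 2) powr (2 * l)"
    using z kantorovich2_ge_1 [OF z] by (simp add: powr_mult)
  also have "\<dots> \<le> (1 - 2 * l) * 1 + (2 * l) * ((1 + z) / 2)"
    using weighted_am_gm [of 1 "(1 + z) / 2" "2 * l"] z l by simp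
  finally show ?thesis
    by (simp add: field_simps)
qed

text \<open>For \<open>l > 1/2\<close>, the previous inequality is applied to \<open>1 / z\<close>
  and \<open>1 - l\<close> and multiplied by \<open>z\<close>; the Kantorovich constant is invariant
  under inversion.\<close>

lemma young_kantorovich:
  fixes l z :: real
  assumes z: "0 < z" and l: "0 \<le> l" "l \<le> 1"
  shows "kantorovich2 z powr (min l (1 - l)) * z powr l \<le> (1 - l) + l * z"
proof (cases "l \<le> 1/2")
  case True
  then show ?thesis
    using young_kantorovich_half [OF z] l by (simp add: min_def)
next
  case False
  then have "kantorovich2 (1 / z) powr (1 - l) * (1 / z) powr (1 - l) \<le> l + (1 - l) * (1 / z)"
    using young_kantorovich_half [of "1 / z" "1 - l"] z l by simp
  then have "kantorovich2 z powr (1 - l) * ((1 / z) powr (1 - l) * z) \<le> (l + (1 - l) * (1 / z)) * z"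
    using z by (simp add: kantorovich2_inverse flip: mult.assoc)
  moreover have "(1 / z) powr (1 - l) * z = z powr l"
    using z by (simp add: powr_diff powr_divide)
  moreover have "(l + (1 - l) * (1 / z)) * z = (1 - l) + l * z"
    using z by (simp add: field_simps)
  ultimately show ?thesis
    using False by (simp add: min_def)
qed

text \<open>For \<open>\<mu> \<le> 1/2\<close>, subtracting \<open>\<mu> * (1 - z)\<^sup>2\<close>
  leaves \<open>(1 - 2 * \<mu>) + 2 * \<mu> * z\<close>, so this is \<open>young_kantorovich\<close>
  with weight \<open>2 * \<mu>\<close>. The other case follows by inversion and multiplication by
  \<open>z\<^sup>2\<close>.\<close>

lemma young_kantorovich_refined:
  fixes \<mu> z r1 :: real
  assumes z: "0 < z" and \<mu>: "0 \<le> \<mu>" "\<mu> \<le> 1" and r1: "r1 = min \<mu> (1 - \<mu>)"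
  shows "kantorovich2 z powr (min (2 * r1) (1 - 2 * r1)) * z powr (2 * \<mu>)
    \<le> (1 - \<mu>) + \<mu> * z\<^sup>2 - r1 * (1 - z)\<^sup>2"
proof (cases "\<mu> \<le> 1/2")
  case True
  then have "r1 = \<mu>"
    by (simp add: r1)
  then show ?thesis
    using young_kantorovich [OF z, of "2 * \<mu>"] \<mu> True by (simp add: power2_eq_square algebra_simps)
next
  case False
  let ?k = "min (2 * (1 - \<mu>)) (1 - 2 * (1 - \<mu>))"
  have r: "r1 = 1 - \<mu>"
    using False by (simp add: r1)
  have "kantorovich2 (1 / z) powr ?k * (1 / z) powr (2 * (1 - \<mu>))
      \<le> (1 - 2 * (1 - \<mu>)) + 2 * (1 - \<mu>) * (1 / z)"
    using young_kantorovich [of "1 / z" "2 * (1 - \<mu>)"] z \<mu> False by simp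
  then have "kantorovich2 z powr ?k * (1 / z) powr (2 * (1 - \<mu>)) * z\<^sup>2
      \<le> ((1 - 2 * (1 - \<mu>)) + 2 * (1 - \<mu>) * (1 / z)) * z\<^sup>2"
    using z by (intro mult_right_mono) (simp_all add: kantorovich2_inverse)
  moreover have "(1 / z) powr (2 * (1 - \<mu>)) * z\<^sup>2 = z powr (2 * \<mu>)"
    using z by (simp add: powr_divide powr_diff algebra_simps powr_numeral)
  moreover have "((1 - 2 * (1 - \<mu>)) + 2 * (1 - \<mu>) * (1 / z)) * z\<^sup>2
      = (1 - \<mu>) + \<mu> * z\<^sup>2 - (1 - \<mu>) * (1 - z)\<^sup>2"
    using z by (simp add: field_simps power2_eq_square)
  ultimately show ?thesis
    by (simp add: r mult.assoc)
qed

text \<open>The refined inequality with \<open>\<mu> = 2 * v\<close> bounds \<open>?Y\<close> from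
  above, while AM-GM gives \<open>?X + ?Y \<ge> 2 * u\<^sup>2\<close>, because the Kantorovich
  factors cancel in \<open>?X * ?Y\<close>. Together they bound \<open>?X\<close> from
  below.\<close>

lemma young_kantorovich_reverse:
  fixes v u r1 k :: real
  assumes u: "0 < u" and v: "0 \<le> v" "v \<le> 1/2"
    and r1: "r1 = min (2 * v) (1 - 2 * v)" and k: "k = min (2 * r1) (1 - 2 * r1)"
  shows "2 * (1 - v) * u\<^sup>2 + r1 * (1 - u)\<^sup>2
    \<le> (1 - 2 * v) + kantorovich2 u powr (- k) * u powr (4 * (1 - v))"
proof -
  let ?X = "kantorovich2 u powr (- k) * u powr (4 * (1 - v))"
  let ?Y = "kantorovich2 u powr k * u powr (4 * v)"
  have K: "0 < kantorovich2 u"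
    using kantorovich2_ge_1 [OF u] by simp
  have Y: "?Y \<le> (1 - 2 * v) + 2 * v * u\<^sup>2 - r1 * (1 - u)\<^sup>2"
    using young_kantorovich_refined [OF u, of "2 * v" r1] v by (simp add: r1 k)
  have "?X * ?Y = (kantorovich2 u powr (- k) * kantorovich2 u powr k) *
      (u powr (4 * (1 - v)) * u powr (4 * v))"
    by (simp only: mult_ac)
  also have "\<dots> = (u\<^sup>2)\<^sup>2"
    using K u by (simp add: powr_add [symmetric] algebra_simps powr_numeral)
  finally have "sqrt (?X * ?Y) = u\<^sup>2"
    by (simp only: real_sqrt_abs abs_power2)
  then have "2 * u\<^sup>2 \<le> ?X + ?Y"
    using arith_geo_mean_sqrt [of ?X ?Y] by simp
  with Y show ?thesis
    by (simp add: algebra_simps add_divide_distrib diff_divide_distrib)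
qed

text \<open>With \<open>u\<close> the fourth root of \<open>x\<close>, the claim is half the sum of
  the reverse inequality at \<open>u\<close> and the one at \<open>1 / u\<close> scaled by
  \<open>u ^ 4\<close>, after \<open>kantorovich2 u\<close> is replaced by the constant at
  \<open>root 4 h\<close>.\<close>

lemma heinz_kantorovich_half:
  fixes v x h r1 k :: real
  assumes h: "1 < h" and x: "0 < x" "h \<le> x \<or> x \<le> 1 / h" and v: "0 \<le> v" "v \<le> 1/2"
    and r1: "r1 = min (2 * v) (1 - 2 * v)" and k: "k = min (2 * r1) (1 - 2 * r1)"
  shows "(1 + x) / 2 \<le> 2 * (1 - v) * ((1 + x) / 2 - x powr (1/2))
     - r1 * ((1 + x) / 2 + x powr (1/2) - (x powr (1/4) + x powr (3/4)))
     + kantorovich2 (root 4 h) powr (- k) * ((x powr v + x powr (1 - v)) / 2)"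
proof -
  define u where "u = x powr (1/4)"
  have u: "0 < u"
    using x by (simp add: u_def)
  have x4: "x = u ^ 4"
    using x by (simp add: u_def powr_numeral [symmetric] powr_powr)
  have powr: "x powr a = u powr (4 * a)" for a
    using x by (simp add: u_def powr_powr)
  have half: "x powr (1/2) = u ^ 2" and quart: "x powr (1/4) = u" and quart3: "x powr (3/4) = u ^ 3"
    using u by (simp_all add: powr powr_numeral)
  have k0: "0 \<le> k"
    using v by (auto simp: k r1 min_def)
  let ?L = "kantorovich2 (root 4 h) powr (- k)"
  have rh: "1 \<le> root 4 h"
    using h by simp
  \<comment> \<open>Either \<open>u\<close> or \<open>1 / u\<close> is at least
    \<open>root 4 h\<close>, and both have the same Kantorovich constant.\<close>
  have "kantorovich2 (root 4 h) \<le> kantorovich2 u"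
  proof (cases "h \<le> x")
    case True
    then have "root 4 h \<le> root 4 (u ^ 4)"
      by (simp add: x4)
    then show ?thesis
      using u by (intro kantorovich2_mono rh) (simp add: real_root_power_cancel)
  next
    case False
    then have "h \<le> 1 / x"
      using x h by (simp add: field_simps)
    then have "root 4 h \<le> root 4 ((1 / u) ^ 4)"
      by (simp add: x4 power_one_over)
    also have "\<dots> = 1 / u"
      using u by (intro real_root_power_cancel) auto
    finally have "root 4 h \<le> 1 / u" .
    then show ?thesis
      using kantorovich2_mono [OF rh] kantorovich2_inverse [OF u] by metis
  qed
  \<comment> \<open>The exponent \<open>- k\<close> is nonpositive, so the comparison
    reverses.\<close>
  then have L: "kantorovich2 u powr (- k) \<le> ?L"
    using k0 kantorovich2_ge_1 [of "root 4 h"] rh by (intro powr_mono2') auto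
  have 1: "2 * (1 - v) * u\<^sup>2 + r1 * (1 - u)\<^sup>2 \<le> (1 - 2 * v) + ?L * u powr (4 * (1 - v))"
    using young_kantorovich_reverse [OF u v r1 k] mult_right_mono [OF L, of "u powr (4 * (1 - v))"]
    by simp
  have "2 * (1 - v) * (1 / u)\<^sup>2 + r1 * (1 - 1 / u)\<^sup>2
      \<le> (1 - 2 * v) + kantorovich2 u powr (- k) * (1 / u) powr (4 * (1 - v))"
    using young_kantorovich_reverse [OF _ v r1 k, of "1 / u"] u
    by (simp only: kantorovich2_inverse zero_less_divide_1_iff)
  also have "\<dots> \<le> (1 - 2 * v) + ?L * (1 / u) powr (4 * (1 - v))"
    using L by (intro add_left_mono mult_right_mono) auto
  finally have "2 * (1 - v) * (1 / u)\<^sup>2 + r1 * (1 - 1 / u)\<^sup>2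
      \<le> (1 - 2 * v) + ?L * (1 / u) powr (4 * (1 - v))" .
  then have "(2 * (1 - v) * (1 / u)\<^sup>2 + r1 * (1 - 1 / u)\<^sup>2) * u ^ 4
      \<le> ((1 - 2 * v) + ?L * (1 / u) powr (4 * (1 - v))) * u ^ 4"
    using u by (intro mult_right_mono) auto
  moreover have "(2 * (1 - v) * (1 / u)\<^sup>2 + r1 * (1 - 1 / u)\<^sup>2) * u ^ 4
      = 2 * (1 - v) * u\<^sup>2 + r1 * (u\<^sup>2 - u)\<^sup>2"
    using u by (simp add: field_simps power2_eq_square power4_eq_xxxx)
  moreover have "(1 / u) powr (4 * (1 - v)) * u ^ 4 = u powr (4 * v)"
    using u by (simp add: powr_divide powr_diff algebra_simps powr_numeral)
  ultimately have 2: "2 * (1 - v) * u\<^sup>2 + r1 * (u\<^sup>2 - u)\<^sup>2 \<le> (1 - 2 * v) * u ^ 4 + ?L * u powr (4 * v)"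
    by (simp add: distrib_right mult.assoc)
  \<comment> \<open>The two correction terms add up to twice the scalar form of the term with the
    Heinz mean at 1/4.\<close>
  have "r1 * (1 - u)\<^sup>2 + r1 * (u\<^sup>2 - u)\<^sup>2 = r1 * (1 + u ^ 4 + 2 * u\<^sup>2 - 2 * (u + u ^ 3))"
    by (simp add: algebra_simps power2_eq_square power3_eq_cube power4_eq_xxxx)
  with 1 2 show ?thesis
    unfolding half quart quart3 powr [of v] powr [of "1 - v"] unfolding x4
    by (simp add: algebra_simps add_divide_distrib diff_divide_distrib)
qed

text \<open>Everything is symmetric under exchanging \<open>v\<close> and \<open>1 - v\<close>, so
  \<open>v\<close> may be replaced by \<open>r \<le> 1/2\<close>.\<close>

lemma heinz_kantorovich:
  fixes v x h r R r1 k :: real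
  assumes h: "1 < h" and x: "0 < x" "h \<le> x \<or> x \<le> 1 / h" and v: "0 < v" "v < 1"
    and r: "r = min v (1 - v)" and R: "R = max v (1 - v)"
    and r1: "r1 = min (2 * r) (1 - 2 * r)" and k: "k = min (2 * r1) (1 - 2 * r1)"
  shows "(1 + x) / 2 \<le> 2 * R * ((1 + x) / 2 - x powr (1/2))
     - r1 * ((1 + x) / 2 + x powr (1/2) - (x powr (1/4) + x powr (3/4)))
     + kantorovich2 (root 4 h) powr (- k) * ((x powr v + x powr (1 - v)) / 2)"
proof -
  have "R = 1 - r" and "x powr v + x powr (1 - v) = x powr r + x powr (1 - r)"
    by (auto simp: r R min_def max_def)
  then show ?thesis
    using heinz_kantorovich_half [OF h x _ _ r1 k] v by (simp add: r min_def)
qed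

subsection \<open>The operator inequality\<close>

lemma loewner_le_imp_inner:
  assumes "S \<preceq> T"
  shows "inner (S x) x \<le> inner (T x) x"
  using assms by (simp add: loewner_le_def positive_op_def Re_cinner blinfun.diff_left inner_diff_left)

lemma bounded_selfadjointI:
  assumes "positive_op A" "c *\<^sub>R id_blinfun \<preceq> A" "A \<preceq> d *\<^sub>R id_blinfun"
  shows "bounded_selfadjoint A c d"
  using assms loewner_le_imp_inner [OF assms(2)] loewner_le_imp_inner [OF assms(3)]
  by unfold_locales (auto simp: positive_op_def blinfun.scaleR_left power2_norm_eq_inner)

lemma positive_op_congruence:
  assumes "selfadjoint S" "positive_op T"
  shows "positive_op (S o\<^sub>L T o\<^sub>L S)"
  using assms selfadjoint_congruence [of S T]
  by (simp add: positive_op_def Re_cinner selfadjoint_inner [of S])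

text \<open>The interval from \<open>b / a'\<close> to \<open>b' / a\<close> encloses the spectrum
  of \<open>C\<close>. The disjunction on \<open>h\<close> puts it to the right of \<open>h\<close>
  or to the left of \<open>1 / h\<close>, so one statement serves both orderings of \<open>A\<close>
  and \<open>B\<close>.\<close>

lemma heinz_kantorovich_operator:
  fixes A B :: "'a::complex_hilbert operator"
  assumes A: "bounded_selfadjoint A a a'" "0 < a" "0 < a'"
    and B: "bounded_selfadjoint B b b'" "0 < b" "0 < b'"
    and h: "1 < h" "h \<le> b / a' \<or> b' / a \<le> 1 / h"
    and v: "0 < v" "v < 1"
    and r: "r = min v (1 - v)" and R: "R = max v (1 - v)"
    and r1: "r1 = min (2 * r) (1 - 2 * r)" and k: "k = min (2 * r1) (1 - 2 * r1)"
  shows "arith_mean (1/2) A B \<preceq>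
      (2 * R) *\<^sub>R (arith_mean (1/2) A B - geom_mean (1/2) A B)
      - r1 *\<^sub>R (arith_mean (1/2) A B + geom_mean (1/2) A B - 2 *\<^sub>R heinz_mean (1/4) A B)
      + (kantorovich2 (root 4 h) powr (- k)) *\<^sub>R heinz_mean v A B" (is "?L \<preceq> ?R")
proof -
  interpret A: bounded_selfadjoint A a a'
    by (rule A)
  interpret B: bounded_selfadjoint B b b'
    by (rule B)
  define S where "S = op_powr A (1/2)"
  define W where "W = op_powr A (-1/2)"
  define C where "C = W o\<^sub>L B o\<^sub>L W"
  have S: "selfadjoint S" and W: "selfadjoint W"
    unfolding S_def W_def using A by (auto intro: A.selfadjoint_op_powr)
  have "S o\<^sub>L W = id_blinfun" "W o\<^sub>L S = id_blinfun" "S o\<^sub>L S = A"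
    unfolding S_def W_def using A by (simp_all add: A.op_powr_add A.op_powr_zero A.op_powr_one)
  then have SW: "S (W x) = x" and WS: "W (S x) = x" and SS: "A x = S (S x)" for x
    by (metis blinfun_apply_blinfun_compose blinfun_apply_id_blinfun)+
  have B_eq: "B x = S (C (S x))" for x
    by (simp add: C_def SW WS)
  have inner_C: "inner (C x) x = inner (B (W x)) (W x)" for x
    by (simp add: C_def selfadjoint_inner [OF W])
  have norm_W: "(norm x)\<^sup>2 = inner (A (W x)) (W x)" for x
    by (simp add: SS SW selfadjoint_inner [OF S] power2_norm_eq_inner)
  \<comment> \<open>The form of \<open>C\<close> at \<open>x\<close> is that of \<open>B\<close> at
    \<open>W x\<close>, and \<open>(norm x)\<^sup>2\<close> is the form of \<open>A\<close> at
    \<open>W x\<close>; dividing the bounds for \<open>B\<close> by those for \<open>A\<close> gives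
    the interval.\<close>
  interpret C: bounded_selfadjoint C "b / a'" "b' / a"
  proof
    show "selfadjoint C"
      unfolding C_def by (intro selfadjoint_congruence W B.selfadjoint)
    fix x
    have "b / a' * (norm x)\<^sup>2 \<le> b / a' * (a' * (norm (W x))\<^sup>2)"
      unfolding norm_W [of x] using A B by (intro mult_left_mono A.upper) auto
    also have "\<dots> = b * (norm (W x))\<^sup>2"
      using A by simp
    also have "\<dots> \<le> inner (C x) x"
      unfolding inner_C by (rule B.lower)
    finally show "b / a' * (norm x)\<^sup>2 \<le> inner (C x) x" .
    have "inner (C x) x \<le> b' * (norm (W x))\<^sup>2"
      unfolding inner_C by (rule B.upper)
    also have "\<dots> = b' / a * (a * (norm (W x))\<^sup>2)"
      using A by simp
    also have "\<dots> \<le> b' / a * (norm x)\<^sup>2"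
      unfolding norm_W [of x] using A B by (intro mult_left_mono A.lower) auto
    finally show "inner (C x) x \<le> b' / a * (norm x)\<^sup>2" .
  qed
  have c: "0 < b / a'"
    using A B by simp
  define \<kappa> where "\<kappa> = kantorovich2 (root 4 h) powr (- k)"
  \<comment> \<open>Right side minus left side of \<open>heinz_kantorovich\<close>, collected into a
    combination of powers that the calculus rules evaluate term by term.\<close>
  define f where "f = (\<lambda>t. (R - r1 / 2 - 1 / 2) * (1 + t) - (2 * R + r1) * t powr (1/2)
      + r1 * (t powr (1/4) + t powr (3/4)) + \<kappa> / 2 * (t powr v + t powr (1 - v)))"
  have cont: "continuous_on {b / a'..b' / a} (\<lambda>t. t powr s)" for s
    by (rule C.continuous_on_powr [OF c])
  have f: "continuous_on {b / a'..b' / a} f"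
    unfolding f_def
    by (intro continuous_on_add continuous_on_diff continuous_on_mult continuous_on_const
        continuous_on_id cont)
  have "0 \<le> f t" if "t \<in> {b / a'..b' / a}" for t
  proof -
    have "0 < t" "h \<le> t \<or> t \<le> 1 / h"
      using that c h by auto
    from heinz_kantorovich [OF h(1) this v r R r1 k] show ?thesis
      by (simp add: f_def \<kappa>_def algebra_simps add_divide_distrib diff_divide_distrib)
  qed
  then have pos: "positive_op (S o\<^sub>L fun_calc f C o\<^sub>L S)"
    using f by (intro positive_op_congruence S C.positive_fun_calc) auto
  have calc: "fun_calc f C = (R - r1 / 2 - 1 / 2) *\<^sub>R (id_blinfun + C)
      - (2 * R + r1) *\<^sub>R op_powr C (1/2)
      + r1 *\<^sub>R (op_powr C (1/4) + op_powr C (3/4))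
      + (\<kappa> / 2) *\<^sub>R (op_powr C v + op_powr C (1 - v))"
    unfolding f_def
    by (simp only: C.fun_calc_add C.fun_calc_diff C.fun_calc_scaleR C.fun_calc_const C.fun_calc_ident
        op_powr_def cont continuous_on_add continuous_on_diff continuous_on_mult continuous_on_const
        continuous_on_id scaleR_one)
  have geom: "geom_mean s A B x = S (op_powr C s (S x))" for s x
    by (simp add: geom_mean_def S_def C_def W_def)
  have "?R - ?L = S o\<^sub>L fun_calc f C o\<^sub>L S"
    unfolding \<kappa>_def [symmetric]
  proof (rule blinfun_eqI)
    fix x
    \<comment> \<open>Testing against an arbitrary \<open>z\<close> turns the comparison of
      coefficients into an identity of real numbers.\<close>
    have "inner z (((2 * R) *\<^sub>R (arith_mean (1/2) A B - geom_mean (1/2) A B)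
      - r1 *\<^sub>R (arith_mean (1/2) A B + geom_mean (1/2) A B - 2 *\<^sub>R heinz_mean (1/4) A B)
      + \<kappa> *\<^sub>R heinz_mean v A B - arith_mean (1/2) A B) x)
      = inner z ((S o\<^sub>L fun_calc f C o\<^sub>L S) x)" for z
      by (simp add: calc arith_mean_def heinz_mean_def geom SS B_eq blinfun.add_left blinfun.diff_left
          blinfun.scaleR_left blinfun.add_right blinfun.diff_right blinfun.scaleR_right
          inner_add_right inner_diff_right)
        (simp add: field_simps)
    then show "((2 * R) *\<^sub>R (arith_mean (1/2) A B - geom_mean (1/2) A B)
      - r1 *\<^sub>R (arith_mean (1/2) A B + geom_mean (1/2) A B - 2 *\<^sub>R heinz_mean (1/4) A B)
      + \<kappa> *\<^sub>R heinz_mean v A B - arith_mean (1/2) A B) x = (S o\<^sub>L fun_calc f C o\<^sub>L S) x"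
      using vector_eq_ldot by blast
  qed
  with pos show ?thesis
    unfolding loewner_le_def by simp
qed

theorem corollary3p2:
  fixes A B :: "'a::complex_hilbert operator"
    and m m' M M' v h r R r1 r1_hat :: real
  assumes separable: "separable_space (euclidean :: 'a topology)"
    and A: "complex_linear A" "positive_op A" "invertible_op A"
    and B: "complex_linear B" "positive_op B" "invertible_op B"
    and pos: "0 < m" "0 < m'" "0 < M" "0 < M'"
    and bounds:
      "(m' *\<^sub>R id_blinfun \<preceq> A \<and> A \<preceq> m *\<^sub>R id_blinfun \<and> m < M
          \<and> M *\<^sub>R id_blinfun \<preceq> B \<and> B \<preceq> M' *\<^sub>R id_blinfun)
       \<or> (m' *\<^sub>R id_blinfun \<preceq> B \<and> B \<preceq> m *\<^sub>R id_blinfun \<and> m < M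
          \<and> M *\<^sub>R id_blinfun \<preceq> A \<and> A \<preceq> M' *\<^sub>R id_blinfun)"
    and v: "0 < v" "v < 1"
    and h: "h = M / m"
    and r: "r = min v (1 - v)"
    and R: "R = max v (1 - v)"
    and r1: "r1 = min (2 * r) (1 - 2 * r)"
    and r1_hat: "r1_hat = min (2 * r1) (1 - 2 * r1)"
  shows "arith_mean (1/2) A B \<preceq>
      (2 * R) *\<^sub>R (arith_mean (1/2) A B - geom_mean (1/2) A B)
      - r1 *\<^sub>R (arith_mean (1/2) A B + geom_mean (1/2) A B - 2 *\<^sub>R heinz_mean (1/4) A B)
      + (kantorovich2 (root 4 h) powr (- r1_hat)) *\<^sub>R heinz_mean v A B"
proof -
  have h1: "1 < h" if "m < M"
    using that pos by (simp add: h)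
  from bounds show ?thesis
  proof (elim disjE conjE)
    assume *: "m' *\<^sub>R id_blinfun \<preceq> A" "A \<preceq> m *\<^sub>R id_blinfun" "m < M"
      "M *\<^sub>R id_blinfun \<preceq> B" "B \<preceq> M' *\<^sub>R id_blinfun"
    show ?thesis
    \<comment> \<open>Here \<open>b / a'\<close> is \<open>M / m\<close>, which equals
      \<open>h\<close>, so the first alternative holds.\<close>
    proof (rule heinz_kantorovich_operator)
      show "bounded_selfadjoint A m' m" "bounded_selfadjoint B M M'"
        using * A B by (auto intro: bounded_selfadjointI)
    qed (use pos v h1 * in \<open>simp_all add: h r R r1 r1_hat\<close>)
  next
    assume *: "m' *\<^sub>R id_blinfun \<preceq> B" "B \<preceq> m *\<^sub>R id_blinfun" "m < M"
      "M *\<^sub>R id_blinfun \<preceq> A" "A \<preceq> M' *\<^sub>R id_blinfun"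
    show ?thesis
    \<comment> \<open>Here \<open>b' / a\<close> is \<open>m / M\<close>, which equals
      \<open>1 / h\<close>, so the second alternative holds.\<close>
    proof (rule heinz_kantorovich_operator)
      show "bounded_selfadjoint A M M'" "bounded_selfadjoint B m' m"
        using * A B by (auto intro: bounded_selfadjointI)
    qed (use pos v h1 * in \<open>simp_all add: h r R r1 r1_hat\<close>)
  qed
qed

end
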